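(* Let $\mathfrak{a}=\mathfrak{a}(\mathfrak{g};\kappa,\lambda,s)$ be a Lie affgebra over a field $\mathbb{K}$ of characteristic not $2$. If $\mathfrak{a}$ is affinely nilpotent, then all elements of $\mathfrak{a}$ are affinely ad-nilpotent.
   Context: For a Lie algebra $(\mathfrak{g},[-,-])$ over $\mathbb{K}$, $\mathbb{K}$-linear maps $\kappa,\lambda:\mathfrak{g}\to\mathfrak{g}$ with $\lambda([a,b])=[\lambda(a),b]+[a,\lambda(b)]-[a,\kappa(b)]$ for all $a,b\in\mathfrak{g}$, and $s\in\mathfrak{g}$, the Lie affgebra $\mathfrak{a}(\mathfrak{g};\kappa,\lambda,s)$ is the set $\mathfrak{g}$ with its affine space structure $\langle a,b,c\rangle=a-b+c$, $\alpha\triangleright_a b=(1-\alpha)a+\alpha b$ ($\alpha\in\mathbb{K}$), and the affine Lie bracket $\{a,b\}=[a,b]+\kappa(a)+\lambda(b-a)+s$. Set $E:=\{x\in\mathfrak{a}\mid \{x,a\}=\{a,x\}=x \text{ for all } a\in\mathfrak{a}\}$; this set is either empty or a singleton. For affine subspaces $\mathfrak{b},\mathfrak{c}$ of $\mathfrak{a}$, $\{\mathfrak{b},\mathfrak{c}\}$ denotes the smallest affine subspace of $\mathfrak{a}$ containing all $\{x,y\}$ with $x\in\mathfrak{b}$, $y\in\mathfrak{c}$. Put $\mathfrak{a}^{(0)}=\mathfrak{a}$ and $\mathfrak{a}^{(m)}=\{\mathfrak{a},\mathfrak{a}^{(m-1)}\}$ for $m\ge 1$. The Lie affgebra $\mathfrak{a}$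 is affinely nilpotent if there is a positive integer $n$ with $\mathfrak{a}^{(n+k)}=\mathfrak{a}^{(n)}=E$ for all $k\in\mathbb{N}$. For $a\in\mathfrak{a}$ let $\mathrm{ad}^{aff}_a:\mathfrak{a}\to\mathfrak{a}$, $\mathrm{ad}^{aff}_a(b)=\{a,b\}$. The element $a$ is affinely ad-nilpotent if there is a natural number $n$ such that, for all $x\in\mathfrak{a}$ and all $k\in\mathbb{N}$, $(\mathrm{ad}^{aff}_a)^{n+k}(x)=(\mathrm{ad}^{aff}_a)^{n}(x)=e$, where $E=\{e\}$ (in particular $E\neq\emptyset$). *)

theory Defs
  imports Complex_Main
begin

locale lie_algebra = vector_space scale
  for scale :: "'k::field \<Rightarrow> 'g::ab_group_add \<Rightarrow> 'g" +
  fixes bracket :: "'g \<Rightarrow> 'g \<Rightarrow> 'g"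
  assumes linear_bracket_right: "Vector_Spaces.linear scale scale (\<lambda>b. bracket a b)"
    and linear_bracket_left: "Vector_Spaces.linear scale scale (\<lambda>a. bracket a b)"
    and bracket_self: "bracket a a = 0"
    and jacobi: "bracket a (bracket b c) + bracket b (bracket c a) + bracket c (bracket a b) = 0"

text \<open>
  The data \<open>(\<gg>; \<kappa>, \<lambda>, s)\<close>. The underlying set of the Lie affgebra is that of the Lie
  algebra, i.e. the whole type. The letter \<open>\<lambda>\<close> is reserved
  syntax, hence the name \<open>lam\<close>. Since \<open>s\<close> is unconstrained, it is not an argument of the locale
  predicate.
\<close>

locale lie_affgebra = lie_algebra scale bracket
  for scale :: "'k::field \<Rightarrow> 'g::ab_group_add \<Rightarrow> 'g"
    and bracket :: "'g \<Rightarrow> 'g \<Rightarrow> 'g" +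
  fixes \<kappa> lam :: "'g \<Rightarrow> 'g" and s :: 'g
  assumes linear_kappa: "Vector_Spaces.linear scale scale \<kappa>"
    and linear_lam: "Vector_Spaces.linear scale scale lam"
    and lam_bracket:
      "lam (bracket a b) = bracket (lam a) b + bracket a (lam b) - bracket a (\<kappa> b)"
begin

definition heap_op :: "'g \<Rightarrow> 'g \<Rightarrow> 'g \<Rightarrow> 'g"
  where "heap_op a b c = a - b + c"

definition aff_act :: "'k \<Rightarrow> 'g \<Rightarrow> 'g \<Rightarrow> 'g"
  where "aff_act \<alpha> a b = scale (1 - \<alpha>) a + scale \<alpha> b"

definition aff_bracket :: "'g \<Rightarrow> 'g \<Rightarrow> 'g"
  where "aff_bracket a b = bracket a b + \<kappa> a + lam (b - a) + s"

definition aff_subspace :: "'g set \<Rightarrow> bool"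
  where "aff_subspace S \<longleftrightarrow>
    (\<forall>a\<in>S. \<forall>b\<in>S. \<forall>c\<in>S. heap_op a b c \<in> S) \<and>
    (\<forall>\<alpha>. \<forall>a\<in>S. \<forall>b\<in>S. aff_act \<alpha> a b \<in> S)"

definition aff_bracket_set :: "'g set \<Rightarrow> 'g set \<Rightarrow> 'g set"
  where "aff_bracket_set B C = aff_subspace hull {aff_bracket x y | x y. x \<in> B \<and> y \<in> C}"

text \<open>The hull is an intersection; this lemma ensures that it is itself an affine subspace.\<close>

lemma aff_subspace_hull: "aff_subspace (aff_subspace hull S)"
  by (rule hull_in) (auto simp: aff_subspace_def)

primrec lower_series :: "nat \<Rightarrow> 'g set"
  where
    "lower_series 0 = UNIV"
  | "lower_series (Suc m) = aff_bracket_set UNIV (lower_series m)"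

definition E :: "'g set"
  where "E = {x. \<forall>a. aff_bracket x a = x \<and> aff_bracket a x = x}"

definition affinely_nilpotent :: bool
  where "affinely_nilpotent \<longleftrightarrow>
    (\<exists>n>0. \<forall>k. lower_series (n + k) = lower_series n \<and> lower_series n = E)"

definition ad_aff :: "'g \<Rightarrow> 'g \<Rightarrow> 'g"
  where "ad_aff a b = aff_bracket a b"

definition affinely_ad_nilpotent :: "'g \<Rightarrow> bool"
  where "affinely_ad_nilpotent a \<longleftrightarrow>
    (\<exists>e. E = {e} \<and>
      (\<exists>n. \<forall>x k. (ad_aff a ^^ (n + k)) x = (ad_aff a ^^ n) x \<and> (ad_aff a ^^ n) x = e))"

end

end

theory Submission
  imports Defs
begin

text \<open>Each term of \<open>lower_series\<close> is generated by brackets whose left entry is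
  arbitrary, so bracketing with a fixed \<open>a\<close> on the left moves down the series by one
  term. Hence the \<open>m\<close>-th iterate of \<open>ad_aff a\<close> lands in
  \<open>lower_series m\<close> (\<open>ad_aff_funpow_mem_lower_series\<close>). Once the series has
  become \<open>E\<close>, which has at most one point (\<open>E_unique\<close>), all iterates are
  constant with that point as value.\<close>

context lie_affgebra
begin

lemma aff_bracket_set_memI:
  assumes "x \<in> B" and "y \<in> C"
  shows "aff_bracket x y \<in> aff_bracket_set B C"
  unfolding aff_bracket_set_def by (rule hull_inc) (use assms in blast)

lemma ad_aff_funpow_mem_lower_series: "(ad_aff a ^^ m) x \<in> lower_series m"
  by (induction m) (simp_all add: ad_aff_def aff_bracket_set_memI)

text \<open>As for zeros of a semigroup: \<open>x\<close> absorbs from the left and \<open>y\<close>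
  from the right, so their bracket equals both.\<close>

lemma E_unique:
  assumes "x \<in> E" and "y \<in> E"
  shows "x = y"
proof -
  have "aff_bracket x y = x" and "aff_bracket x y = y"
    using assms unfolding E_def by blast+
  then show ?thesis by simp
qed

lemma affinely_nilpotent_imp_affinely_ad_nilpotent:
  assumes "affinely_nilpotent"
  shows "affinely_ad_nilpotent a"
proof -
  obtain n where n: "\<And>k. lower_series (n + k) = E"
    using assms unfolding affinely_nilpotent_def by metis
  have in_E: "(ad_aff a ^^ (n + k)) x \<in> E" for x k
    using ad_aff_funpow_mem_lower_series[where m = "n + k"] n by simp
  \<comment> \<open>A priori \<open>E\<close> could be empty; an iterate at any starting point, here
    \<open>0\<close>, shows that it is not.\<close>
  define e where "e = (ad_aff a ^^ n) 0"
  have "e \<in> E"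
    using in_E[of 0] by (simp add: e_def)
  then have E: "E = {e}"
    using E_unique by blast
  have "(ad_aff a ^^ (n + k)) x = e" for x k
    using in_E E by blast
  from this this[where k = 0]
  have "\<forall>x k. (ad_aff a ^^ (n + k)) x = (ad_aff a ^^ n) x \<and> (ad_aff a ^^ n) x = e"
    by simp
  with E show ?thesis
    unfolding affinely_ad_nilpotent_def by blast
qed

end

theorem proposition7p1:
  fixes scale :: "'k::field \<Rightarrow> 'g::ab_group_add \<Rightarrow> 'g"
    and bracket :: "'g \<Rightarrow> 'g \<Rightarrow> 'g"
    and \<kappa> lam :: "'g \<Rightarrow> 'g" and s :: 'g
  assumes "CHAR('k) \<noteq> 2"
    and "lie_affgebra scale bracket \<kappa> lam"
    and "lie_affgebra.affinely_nilpotent scale bracket \<kappa> lam s"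
  shows "\<forall>a. lie_affgebra.affinely_ad_nilpotent bracket \<kappa> lam s a"
  using lie_affgebra.affinely_nilpotent_imp_affinely_ad_nilpotent[OF assms(2,3)] by blast

end
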